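(* In the ordered adjoint sequent calculus in which the identity rule is restricted to atomic propositions (i.e. only $x{:}P_m\vdash P_m$ for atomic $P_m$ is an axiom), the sequent $x{:}A_m\vdash A_m$ is derivable for every proposition $A_m$; that is, the unrestricted identity rule is admissible.
   Context: Ordered adjoint sequent calculus. Fix a preorder $(\mathcal{M},\geq)$ of modes and, for each mode $m$, a set $\sigma(m)\subseteq\{\mathsf{W},\mathsf{C}^\leftarrow,\mathsf{C}^\rightarrow,\mathsf{M}^\leftarrow,\mathsf{M}^\rightarrow\}$, monotone: $k\geq m$ implies $\sigma(k)\supseteq\sigma(m)$. Propositions: $A_m ::= P_m \mid A_m \rightarrowtail B_m \mid A_m \twoheadrightarrow B_m \mid A_m \,\&\, B_m \mid {\uparrow}^m_l A_l\ (m\geq l) \mid A_m\bullet B_m \mid 1_m \mid A_m\oplus B_m \mid {\downarrow}^k_m A_k\ (k\geq m)$, with $P_m$ atomic. An ordered context $\Omega$ is a finite sequence of labeled antecedents $x{:}A_m$; a variable may occur several times, all occurrences labeling the same proposition. $\Omega\geq m$ means every antecedent $y{:}B_k$ of $\Omega$ has $k\geq m$. A sequent $\Omega\vdash C_r$ presupposes $\Omega\geq r$. Newly introduced variables in premises are fresh. Rules (premises $\Rightarrow$ conclusion): (id) $\Rightarrow x{:}A_m\vdash A_m$. (cut) $\Omega_A\vdash A_m$ and $\Omega_L(x{:}A_m)\Omega_R\vdash C_r$ with $\Omega_A\geq m\geq r$ $\Rightarrow \Omega_L\Omega_A\Omega_R\vdash C_r$. ($1R$) $\Rightarrow \cdot\vdash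 1_m$. ($1L$) $\Omega_L\Omega_R\vdash C_r \Rightarrow \Omega_L(x{:}1_m)\Omega_R\vdash C_r$. ($\bullet R$) $\Omega_1\vdash A_m$, $\Omega_2\vdash B_m\Rightarrow \Omega_1\Omega_2\vdash A_m\bullet B_m$. ($\bullet L$) $\Omega_L(x_1{:}A_m)(x_2{:}B_m)\Omega_R\vdash C_r\Rightarrow\Omega_L(x{:}A_m\bullet B_m)\Omega_R\vdash C_r$. ($\oplus R_i$) $\Omega\vdash A_m$ (resp. $\Omega\vdash B_m$) $\Rightarrow\Omega\vdash A_m\oplus B_m$. ($\oplus L$) $\Omega_L(y{:}A_m)\Omega_R\vdash C_r$ and $\Omega_L(y{:}B_m)\Omega_R\vdash C_r\Rightarrow\Omega_L(x{:}A_m\oplus B_m)\Omega_R\vdash C_r$. (${\downarrow}R$) $\Omega\vdash A_k$ with $\Omega\geq k\Rightarrow\Omega\vdash{\downarrow}^k_mA_k$. (${\downarrow}L$) $\Omega_L(y{:}A_k)\Omega_R\vdash C_r\Rightarrow\Omega_L(x{:}{\downarrow}^k_mA_k)\Omega_R\vdash C_r$. ($\twoheadrightarrow R$) $\Omega(x{:}A_m)\vdash B_m\Rightarrow\Omega\vdash A_m\twoheadrightarrow B_m$. ($\twoheadrightarrow L$) $\Omega_A\vdash A_m$, $\Omega_A\geq m$, $\Omega_L(y{:}B_m)\Omega_R\vdash C_r\Rightarrow\Omega_L(f{:}A_m\twoheadrightarrow B_m)\Omega_A\Omega_R\vdash C_r$. ($\rightarrowtail R$) $(x{:}A_m)\Omega\vdash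 B_m\Rightarrow\Omega\vdash A_m\rightarrowtail B_m$. ($\rightarrowtail L$) $\Omega_A\vdash A_m$, $\Omega_A\geq m$, $\Omega_L(y{:}B_m)\Omega_R\vdash C_r\Rightarrow\Omega_L\Omega_A(f{:}A_m\rightarrowtail B_m)\Omega_R\vdash C_r$. ($\& R$) $\Omega\vdash A_m$, $\Omega\vdash B_m\Rightarrow\Omega\vdash A_m\&B_m$. ($\& L_i$) $\Omega_L(y{:}A_m)\Omega_R\vdash C_r$ (resp. $y{:}B_m$) $\Rightarrow\Omega_L(x{:}A_m\&B_m)\Omega_R\vdash C_r$. (${\uparrow}R$) $\Omega\vdash A_l\Rightarrow\Omega\vdash{\uparrow}^m_lA_l$. (${\uparrow}L$) $\Omega_L(y{:}A_l)\Omega_R\vdash C_r$ with $l\geq r\Rightarrow\Omega_L(x{:}{\uparrow}^m_lA_l)\Omega_R\vdash C_r$. Structural rules: ($\mathsf{M}^\leftarrow$) $\Omega_L\Omega_M(x{:}A_m)\Omega_R\vdash C_r$, $\mathsf{M}^\leftarrow\in\sigma(m)\Rightarrow\Omega_L(x{:}A_m)\Omega_M\Omega_R\vdash C_r$. ($\mathsf{M}^\rightarrow$) $\Omega_L(x{:}A_m)\Omega_M\Omega_R\vdash C_r$, $\mathsf{M}^\rightarrow\in\sigma(m)\Rightarrow\Omega_L\Omega_M(x{:}A_m)\Omega_R\vdash C_r$. ($\mathsf{C}^\leftarrow$) $\Omega_L(x{:}A_m)\Omega_M(x{:}A_m)\Omega_R\vdash C_r$, $\mathsf{C}^\leftarrow\in\sigma(m)\Rightarrow\Omega_L(x{:}A_m)\Omega_M\Omega_R\vdash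 C_r$. ($\mathsf{C}^\rightarrow$) same premise, $\mathsf{C}^\rightarrow\in\sigma(m)\Rightarrow\Omega_L\Omega_M(x{:}A_m)\Omega_R\vdash C_r$. ($\mathsf{W}$) $\Omega_L\Omega_R\vdash C_r$, $\mathsf{W}\in\sigma(m)\Rightarrow\Omega_L(x{:}A_m)\Omega_R\vdash C_r$. *)

theory Defs
  imports "HOL-Library.Infinite_Typeclass"
begin

text \<open>
  Modes are the elements of a type \<open>'m\<close> of class \<open>preorder\<close>.  Structural properties: weakening,
  and contraction and mobility in the two variants \<open>\<leftarrow>\<close> (\<open>L\<close>) and \<open>\<rightarrow>\<close> (\<open>R\<close>).
\<close>

datatype strprop = Wk | CtrL | CtrR | MvL | MvR

text \<open>
  Raw propositions (\<open>Fuse\<close> is the ordered conjunction \<open>\<bullet>\<close>) over a type \<open>'a\<close> of atom names.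
  Only atoms, the unit and the shifts carry a mode annotation; all other modes are computed by \<open>mode_of\<close>.  \<open>LImp A B\<close> is
  \<open>A\<^sub>m \<rightarrowtail> B\<^sub>m\<close> (the argument is added at the left end of the context), \<open>RImp A B\<close> is the
  double-headed arrow (argument at the right end).  \<open>Up m A\<close> and \<open>Down m A\<close> are the shifts
  of \<open>A\<close> from its own mode up, respectively down, to \<open>m\<close>.
\<close>

datatype ('a, 'm) prp =
    Atom 'm 'a
  | LImp "('a, 'm) prp" "('a, 'm) prp"
  | RImp "('a, 'm) prp" "('a, 'm) prp"
  | With "('a, 'm) prp" "('a, 'm) prp"
  | Up 'm "('a, 'm) prp"
  | Fuse "('a, 'm) prp" "('a, 'm) prp"
  | One 'm
  | Plus "('a, 'm) prp" "('a, 'm) prp"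
  | Down 'm "('a, 'm) prp"

primrec mode_of :: "('a, 'm) prp \<Rightarrow> 'm" where
  "mode_of (Atom m P) = m"
| "mode_of (LImp A B) = mode_of A"
| "mode_of (RImp A B) = mode_of A"
| "mode_of (With A B) = mode_of A"
| "mode_of (Up m A) = m"
| "mode_of (Fuse A B) = mode_of A"
| "mode_of (One m) = m"
| "mode_of (Plus A B) = mode_of A"
| "mode_of (Down m A) = m"

text \<open>\<open>wf_prp A\<close>: the raw term \<open>A\<close> is a proposition (of mode \<open>mode_of A\<close>).\<close>

primrec wf_prp :: "('a, 'm::preorder) prp \<Rightarrow> bool" where
  "wf_prp (Atom m P) \<longleftrightarrow> True"
| "wf_prp (LImp A B) \<longleftrightarrow> wf_prp A \<and> wf_prp B \<and> mode_of A = mode_of B"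
| "wf_prp (RImp A B) \<longleftrightarrow> wf_prp A \<and> wf_prp B \<and> mode_of A = mode_of B"
| "wf_prp (With A B) \<longleftrightarrow> wf_prp A \<and> wf_prp B \<and> mode_of A = mode_of B"
| "wf_prp (Up m A) \<longleftrightarrow> wf_prp A \<and> m \<ge> mode_of A"
| "wf_prp (Fuse A B) \<longleftrightarrow> wf_prp A \<and> wf_prp B \<and> mode_of A = mode_of B"
| "wf_prp (One m) \<longleftrightarrow> True"
| "wf_prp (Plus A B) \<longleftrightarrow> wf_prp A \<and> wf_prp B \<and> mode_of A = mode_of B"
| "wf_prp (Down m A) \<longleftrightarrow> wf_prp A \<and> mode_of A \<ge> m"

definition atomic :: "('a, 'm) prp \<Rightarrow> bool" where
  "atomic A \<longleftrightarrow> (\<exists>m P. A = Atom m P)"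

type_synonym ('v, 'a, 'm) ctx = "('v \<times> ('a, 'm) prp) list"
type_synonym ('v, 'a, 'm) seq = "('v, 'a, 'm) ctx \<times> ('a, 'm) prp"

definition vars :: "('v, 'a, 'm) ctx \<Rightarrow> 'v set" where
  "vars \<Omega> = fst ` set \<Omega>"

definition ctx_ge :: "('v, 'a, 'm::preorder) ctx \<Rightarrow> 'm \<Rightarrow> bool" where
  "ctx_ge \<Omega> m \<longleftrightarrow> (\<forall>(y, B) \<in> set \<Omega>. mode_of B \<ge> m)"

text \<open>
  The presuppositions of a sequent: everything in it is a proposition, all occurrences of a
  variable label the same proposition, and every antecedent is at or above the mode of the succedent.
\<close>

definition wf_seq :: "('v, 'a, 'm::preorder) seq \<Rightarrow> bool" where
  "wf_seq = (\<lambda>(\<Omega>, C).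
     wf_prp C \<and> (\<forall>(y, B) \<in> set \<Omega>. wf_prp B) \<and>
     (\<forall>(x, A) \<in> set \<Omega>. \<forall>(y, B) \<in> set \<Omega>. x = y \<longrightarrow> A = B) \<and>
     ctx_ge \<Omega> (mode_of C))"

text \<open>
  \<open>rule_inst \<sigma> I ps s\<close>: there is a rule instance with premises \<open>ps\<close> and conclusion \<open>s\<close>.
  The parameter \<open>I\<close> singles out the propositions at which the identity rule may be used.
  A variable introduced in a premise is fresh when it does not occur in the conclusion.
\<close>

inductive rule_inst ::
  "('m::preorder \<Rightarrow> strprop set) \<Rightarrow> (('a, 'm) prp \<Rightarrow> bool) \<Rightarrow>
   ('v, 'a, 'm) seq list \<Rightarrow> ('v, 'a, 'm) seq \<Rightarrow> bool"
  for \<sigma> :: "'m \<Rightarrow> strprop set" and I :: "('a, 'm) prp \<Rightarrow> bool"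
where
  Id: "I A \<Longrightarrow> rule_inst \<sigma> I [] ([(x, A)], A)"
| Cut: "\<lbrakk>ctx_ge \<Omega>\<^sub>A (mode_of A); mode_of A \<ge> mode_of C; x \<notin> vars (\<Omega>\<^sub>L @ \<Omega>\<^sub>A @ \<Omega>\<^sub>R)\<rbrakk> \<Longrightarrow>
    rule_inst \<sigma> I [(\<Omega>\<^sub>A, A), (\<Omega>\<^sub>L @ [(x, A)] @ \<Omega>\<^sub>R, C)] (\<Omega>\<^sub>L @ \<Omega>\<^sub>A @ \<Omega>\<^sub>R, C)"
| OneR: "rule_inst \<sigma> I [] ([], One m)"
| OneL: "rule_inst \<sigma> I [(\<Omega>\<^sub>L @ \<Omega>\<^sub>R, C)] (\<Omega>\<^sub>L @ [(x, One m)] @ \<Omega>\<^sub>R, C)"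
| FuseR: "rule_inst \<sigma> I [(\<Omega>\<^sub>1, A), (\<Omega>\<^sub>2, B)] (\<Omega>\<^sub>1 @ \<Omega>\<^sub>2, Fuse A B)"
| FuseL: "\<lbrakk>x\<^sub>1 \<noteq> x\<^sub>2; x\<^sub>1 \<notin> vars (\<Omega>\<^sub>L @ [(x, Fuse A B)] @ \<Omega>\<^sub>R); x\<^sub>2 \<notin> vars (\<Omega>\<^sub>L @ [(x, Fuse A B)] @ \<Omega>\<^sub>R)\<rbrakk> \<Longrightarrow>
    rule_inst \<sigma> I [(\<Omega>\<^sub>L @ [(x\<^sub>1, A), (x\<^sub>2, B)] @ \<Omega>\<^sub>R, C)] (\<Omega>\<^sub>L @ [(x, Fuse A B)] @ \<Omega>\<^sub>R, C)"
| PlusR1: "rule_inst \<sigma> I [(\<Omega>, A)] (\<Omega>, Plus A B)"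
| PlusR2: "rule_inst \<sigma> I [(\<Omega>, B)] (\<Omega>, Plus A B)"
| PlusL: "y \<notin> vars (\<Omega>\<^sub>L @ [(x, Plus A B)] @ \<Omega>\<^sub>R) \<Longrightarrow>
    rule_inst \<sigma> I [(\<Omega>\<^sub>L @ [(y, A)] @ \<Omega>\<^sub>R, C), (\<Omega>\<^sub>L @ [(y, B)] @ \<Omega>\<^sub>R, C)]
      (\<Omega>\<^sub>L @ [(x, Plus A B)] @ \<Omega>\<^sub>R, C)"
| DownR: "ctx_ge \<Omega> (mode_of A) \<Longrightarrow> rule_inst \<sigma> I [(\<Omega>, A)] (\<Omega>, Down m A)"
| DownL: "y \<notin> vars (\<Omega>\<^sub>L @ [(x, Down m A)] @ \<Omega>\<^sub>R) \<Longrightarrow>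
    rule_inst \<sigma> I [(\<Omega>\<^sub>L @ [(y, A)] @ \<Omega>\<^sub>R, C)] (\<Omega>\<^sub>L @ [(x, Down m A)] @ \<Omega>\<^sub>R, C)"
| RImpR: "x \<notin> vars \<Omega> \<Longrightarrow> rule_inst \<sigma> I [(\<Omega> @ [(x, A)], B)] (\<Omega>, RImp A B)"
| RImpL: "\<lbrakk>ctx_ge \<Omega>\<^sub>A (mode_of A); y \<notin> vars (\<Omega>\<^sub>L @ [(f, RImp A B)] @ \<Omega>\<^sub>A @ \<Omega>\<^sub>R)\<rbrakk> \<Longrightarrow>
    rule_inst \<sigma> I [(\<Omega>\<^sub>A, A), (\<Omega>\<^sub>L @ [(y, B)] @ \<Omega>\<^sub>R, C)]
      (\<Omega>\<^sub>L @ [(f, RImp A B)] @ \<Omega>\<^sub>A @ \<Omega>\<^sub>R, C)"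
| LImpR: "x \<notin> vars \<Omega> \<Longrightarrow> rule_inst \<sigma> I [([(x, A)] @ \<Omega>, B)] (\<Omega>, LImp A B)"
| LImpL: "\<lbrakk>ctx_ge \<Omega>\<^sub>A (mode_of A); y \<notin> vars (\<Omega>\<^sub>L @ \<Omega>\<^sub>A @ [(f, LImp A B)] @ \<Omega>\<^sub>R)\<rbrakk> \<Longrightarrow>
    rule_inst \<sigma> I [(\<Omega>\<^sub>A, A), (\<Omega>\<^sub>L @ [(y, B)] @ \<Omega>\<^sub>R, C)]
      (\<Omega>\<^sub>L @ \<Omega>\<^sub>A @ [(f, LImp A B)] @ \<Omega>\<^sub>R, C)"
| WithR: "rule_inst \<sigma> I [(\<Omega>, A), (\<Omega>, B)] (\<Omega>, With A B)"
| WithL1: "y \<notin> vars (\<Omega>\<^sub>L @ [(x, With A B)] @ \<Omega>\<^sub>R) \<Longrightarrow>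
    rule_inst \<sigma> I [(\<Omega>\<^sub>L @ [(y, A)] @ \<Omega>\<^sub>R, C)] (\<Omega>\<^sub>L @ [(x, With A B)] @ \<Omega>\<^sub>R, C)"
| WithL2: "y \<notin> vars (\<Omega>\<^sub>L @ [(x, With A B)] @ \<Omega>\<^sub>R) \<Longrightarrow>
    rule_inst \<sigma> I [(\<Omega>\<^sub>L @ [(y, B)] @ \<Omega>\<^sub>R, C)] (\<Omega>\<^sub>L @ [(x, With A B)] @ \<Omega>\<^sub>R, C)"
| UpR: "rule_inst \<sigma> I [(\<Omega>, A)] (\<Omega>, Up m A)"
| UpL: "\<lbrakk>mode_of A \<ge> mode_of C; y \<notin> vars (\<Omega>\<^sub>L @ [(x, Up m A)] @ \<Omega>\<^sub>R)\<rbrakk> \<Longrightarrow>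
    rule_inst \<sigma> I [(\<Omega>\<^sub>L @ [(y, A)] @ \<Omega>\<^sub>R, C)] (\<Omega>\<^sub>L @ [(x, Up m A)] @ \<Omega>\<^sub>R, C)"
| MoveL: "MvL \<in> \<sigma> (mode_of A) \<Longrightarrow>
    rule_inst \<sigma> I [(\<Omega>\<^sub>L @ \<Omega>\<^sub>M @ [(x, A)] @ \<Omega>\<^sub>R, C)] (\<Omega>\<^sub>L @ [(x, A)] @ \<Omega>\<^sub>M @ \<Omega>\<^sub>R, C)"
| MoveR: "MvR \<in> \<sigma> (mode_of A) \<Longrightarrow>
    rule_inst \<sigma> I [(\<Omega>\<^sub>L @ [(x, A)] @ \<Omega>\<^sub>M @ \<Omega>\<^sub>R, C)] (\<Omega>\<^sub>L @ \<Omega>\<^sub>M @ [(x, A)] @ \<Omega>\<^sub>R, C)"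
| ConL: "CtrL \<in> \<sigma> (mode_of A) \<Longrightarrow>
    rule_inst \<sigma> I [(\<Omega>\<^sub>L @ [(x, A)] @ \<Omega>\<^sub>M @ [(x, A)] @ \<Omega>\<^sub>R, C)] (\<Omega>\<^sub>L @ [(x, A)] @ \<Omega>\<^sub>M @ \<Omega>\<^sub>R, C)"
| ConR: "CtrR \<in> \<sigma> (mode_of A) \<Longrightarrow>
    rule_inst \<sigma> I [(\<Omega>\<^sub>L @ [(x, A)] @ \<Omega>\<^sub>M @ [(x, A)] @ \<Omega>\<^sub>R, C)] (\<Omega>\<^sub>L @ \<Omega>\<^sub>M @ [(x, A)] @ \<Omega>\<^sub>R, C)"
| Weak: "Wk \<in> \<sigma> (mode_of A) \<Longrightarrow>
    rule_inst \<sigma> I [(\<Omega>\<^sub>L @ \<Omega>\<^sub>R, C)] (\<Omega>\<^sub>L @ [(x, A)] @ \<Omega>\<^sub>R, C)"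

text \<open>Every sequent in a derivation has to satisfy the presuppositions.\<close>

inductive derivable ::
  "('m::preorder \<Rightarrow> strprop set) \<Rightarrow> (('a, 'm) prp \<Rightarrow> bool) \<Rightarrow> ('v, 'a, 'm) seq \<Rightarrow> bool"
  for \<sigma> :: "'m \<Rightarrow> strprop set" and I :: "('a, 'm) prp \<Rightarrow> bool"
where
  derive_step: "\<lbrakk>rule_inst \<sigma> I ps s; wf_seq s; \<forall>p \<in> set ps. derivable \<sigma> I p\<rbrakk> \<Longrightarrow> derivable \<sigma> I s"

text \<open>The calculus with unrestricted identity, and the one with identity at atoms only.\<close>

abbreviation derivable_full ::
  "('m::preorder \<Rightarrow> strprop set) \<Rightarrow> ('v, 'a, 'm) seq \<Rightarrow> bool" where
  "derivable_full \<sigma> \<equiv> derivable \<sigma> (\<lambda>_. True)"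

abbreviation derivable_atomic ::
  "('m::preorder \<Rightarrow> strprop set) \<Rightarrow> ('v, 'a, 'm) seq \<Rightarrow> bool" where
  "derivable_atomic \<sigma> \<equiv> derivable \<sigma> atomic"

end

theory Submission
  imports Defs
begin

text \<open>
  Identity expansion by induction on the proposition: decompose it once with its invertible rule
  (the left rule for positive, the right rule for negative connectives), then with the opposite
  rule, and close with the identities at the components.  The rules of the two calculi
  agree apart from identity, so a full derivation becomes an atomic one by expanding its axioms.
\<close>

lemma ctx_ge_Nil [simp]: "ctx_ge [] m"
  by (simp add: ctx_ge_def)

lemma ctx_ge_Cons [simp]: "ctx_ge ((x, A) # \<Omega>) m \<longleftrightarrow> mode_of A \<ge> m \<and> ctx_ge \<Omega> m"
  by (simp add: ctx_ge_def)

lemma vars_Nil [simp]: "vars [] = {}"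
  by (simp add: vars_def)

lemma vars_Cons [simp]: "vars ((x, A) # \<Omega>) = insert x (vars \<Omega>)"
  by (simp add: vars_def)

lemma wf_seq_Nil [simp]: "wf_seq ([], C) \<longleftrightarrow> wf_prp C"
  by (simp add: wf_seq_def)

lemma wf_seq_singleton [simp]:
  "wf_seq ([(x, A)], C) \<longleftrightarrow> wf_prp A \<and> wf_prp C \<and> mode_of A \<ge> mode_of C"
  by (auto simp: wf_seq_def)

text \<open>Distinct variables make the condition of one proposition per variable vacuous.\<close>

lemma wf_seq_pair [simp]:
  "x \<noteq> y \<Longrightarrow> wf_seq ([(x, A), (y, B)], C) \<longleftrightarrow>
     wf_prp A \<and> wf_prp B \<and> wf_prp C \<and> mode_of A \<ge> mode_of C \<and> mode_of B \<ge> mode_of C"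
  by (auto simp: wf_seq_def)

text \<open>Freshness side conditions can always be met because the type of variables is
  infinite.\<close>

lemma fresh_variable:
  fixes x :: "'v::infinite"
  obtains y where "y \<noteq> x"
  using ex_new_if_finite[OF infinite_UNIV, of "{x}"] by auto

lemma fresh_variable2:
  fixes x y :: "'v::infinite"
  obtains z where "z \<noteq> x" "z \<noteq> y"
  using ex_new_if_finite[OF infinite_UNIV, of "{x, y}"] by auto

lemma identity_expansion:
  fixes x :: "'v::infinite" and A :: "('a, 'm::preorder) prp"
  assumes "wf_prp A"
  shows "derivable_atomic \<sigma> ([(x, A)], A)"
  using assms
\<comment> \<open>The variable is generalized since the induction hypotheses are applied at the
  fresh variables of the premises.\<close>
proof (induction A arbitrary: x)
  case (Atom m P)
  show ?case
    by (rule derive_step[OF Id]) (auto simp: atomic_def)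
next
  case (LImp A B)
  obtain a where a: "a \<noteq> x" by (rule fresh_variable)
  obtain b where b: "b \<noteq> x" "b \<noteq> a" by (rule fresh_variable2)
  have "derivable_atomic \<sigma> ([(a, A), (x, LImp A B)], B)"
    \<comment> \<open>The premises are the identities \<open>a : A\<close> and \<open>b : B\<close>.
      The condition \<open>ctx_ge\<close> holds because the argument context is just
      \<open>a : A\<close>, and \<open>b\<close> must avoid both \<open>a\<close> and
      \<open>x\<close>, which occur in the conclusion.\<close>
    by (rule derive_step[OF LImpL[where \<Omega>\<^sub>L = "[]" and \<Omega>\<^sub>A = "[(a, A)]" and \<Omega>\<^sub>R = "[]" and y = b, simplified]])
      (use LImp a b in auto)
  then show ?case
    by (intro derive_step[OF LImpR[where x = a]]) (use LImp a in auto)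
next
  case (RImp A B)
  obtain a where a: "a \<noteq> x" by (rule fresh_variable)
  obtain b where b: "b \<noteq> x" "b \<noteq> a" by (rule fresh_variable2)
  have "derivable_atomic \<sigma> ([(x, RImp A B), (a, A)], B)"
    by (rule derive_step[OF RImpL[where \<Omega>\<^sub>L = "[]" and \<Omega>\<^sub>A = "[(a, A)]" and \<Omega>\<^sub>R = "[]" and y = b, simplified]])
      (use RImp a b in auto)
  then show ?case
    by (intro derive_step[OF RImpR[where x = a]]) (use RImp a in auto)
next
  case (With A B)
  obtain y where y: "y \<noteq> x" by (rule fresh_variable)
  have "derivable_atomic \<sigma> ([(x, With A B)], A)"
    by (rule derive_step[OF WithL1[where \<Omega>\<^sub>L = "[]" and \<Omega>\<^sub>R = "[]" and y = y, simplified]])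
      (use With y in auto)
  moreover have "derivable_atomic \<sigma> ([(x, With A B)], B)"
    by (rule derive_step[OF WithL2[where \<Omega>\<^sub>L = "[]" and \<Omega>\<^sub>R = "[]" and y = y, simplified]])
      (use With y in auto)
  ultimately show ?case
    by (intro derive_step[OF WithR]) (use With in auto)
next
  case (Up m A)
  obtain y where y: "y \<noteq> x" by (rule fresh_variable)
  \<comment> \<open>The order matters: \<open>UpL\<close> needs the mode of \<open>A\<close> to be
    at or above that of the succedent, which holds once \<open>UpR\<close> has turned the succedent
    into \<open>A\<close> but can fail for \<open>Up m A\<close>.\<close>
  have "derivable_atomic \<sigma> ([(x, Up m A)], A)"
    by (rule derive_step[OF UpL[where \<Omega>\<^sub>L = "[]" and \<Omega>\<^sub>R = "[]" and y = y, simplified]])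
      (use Up y in auto)
  then show ?case
    by (intro derive_step[OF UpR]) (use Up in auto)
next
  case (Fuse A B)
  obtain a where a: "a \<noteq> x" by (rule fresh_variable)
  obtain b where b: "b \<noteq> x" "b \<noteq> a" by (rule fresh_variable2)
  have "derivable_atomic \<sigma> ([(a, A), (b, B)], Fuse A B)"
    by (rule derive_step[OF FuseR[where \<Omega>\<^sub>1 = "[(a, A)]" and \<Omega>\<^sub>2 = "[(b, B)]", simplified]])
      (use Fuse b in auto)
  then show ?case
    by (intro derive_step[OF FuseL[where \<Omega>\<^sub>L = "[]" and \<Omega>\<^sub>R = "[]" and x\<^sub>1 = a and x\<^sub>2 = b, simplified]])
      (use Fuse a b in auto)
next
  case (One m)
  have "derivable_atomic \<sigma> ([] :: ('v, 'a, 'm) ctx, One m)"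
    by (rule derive_step[OF OneR]) auto
  then show ?case
    by (intro derive_step[OF OneL[where \<Omega>\<^sub>L = "[]" and \<Omega>\<^sub>R = "[]", simplified]]) auto
next
  case (Plus A B)
  obtain y where y: "y \<noteq> x" by (rule fresh_variable)
  \<comment> \<open>Both branches use the same \<open>y\<close>, as \<open>PlusL\<close>
    demands.\<close>
  have "derivable_atomic \<sigma> ([(y, A)], Plus A B)"
    by (rule derive_step[OF PlusR1]) (use Plus in auto)
  moreover have "derivable_atomic \<sigma> ([(y, B)], Plus A B)"
    by (rule derive_step[OF PlusR2]) (use Plus in auto)
  ultimately show ?case
    by (intro derive_step[OF PlusL[where \<Omega>\<^sub>L = "[]" and \<Omega>\<^sub>R = "[]" and y = y, simplified]])
      (use Plus y in auto)
next
  case (Down m A)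
  obtain y where y: "y \<noteq> x" by (rule fresh_variable)
  \<comment> \<open>Dually to \<open>Up\<close>, \<open>DownR\<close> needs a context at or above
    the mode of \<open>A\<close>, which is guaranteed only after \<open>DownL\<close> has replaced
    \<open>Down m A\<close> by \<open>A\<close>.\<close>
  have "derivable_atomic \<sigma> ([(y, A)], Down m A)"
    by (rule derive_step[OF DownR]) (use Down in auto)
  then show ?case
    by (intro derive_step[OF DownL[where \<Omega>\<^sub>L = "[]" and \<Omega>\<^sub>R = "[]" and y = y, simplified]])
      (use Down y in auto)
qed

text \<open>Only \<open>Id\<close> depends on the parameter \<open>I\<close>; every other rule
  carries over verbatim.\<close>

lemma rule_inst_change_identity:
  assumes "rule_inst \<sigma> I ps s"
  shows "rule_inst \<sigma> J ps s \<or> (\<exists>x A. s = ([(x, A)], A))"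
  using assms by cases (blast intro: rule_inst.intros)+

lemma derivable_full_imp_atomic:
  fixes s :: "('v::infinite, 'a, 'm::preorder) seq"
  assumes "derivable_full \<sigma> s"
  shows "derivable_atomic \<sigma> s"
  using assms
proof (induction rule: derivable.induct)
  case (derive_step ps s)
  from rule_inst_change_identity[OF derive_step.hyps(1)]
  consider "rule_inst \<sigma> atomic ps s" | x A where "s = ([(x, A)], A)"
    by blast
  then show ?case
  proof cases
    case 1
    then show ?thesis
      using derive_step.hyps(2) derive_step.IH by (intro derivable.derive_step[OF 1]) auto
  next
    case 2
    then show ?thesis
      \<comment> \<open>The presupposition \<open>wf_seq s\<close> supplies the
        \<open>wf_prp A\<close> that the expansion requires.\<close>
      using derive_step.hyps(2) by (simp add: identity_expansion)
  qed
qed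

theorem theorem3:
  fixes \<sigma> :: "'m::preorder \<Rightarrow> strprop set"
  assumes mono: "\<And>k m. k \<ge> m \<Longrightarrow> \<sigma> k \<supseteq> \<sigma> m"
  shows "(\<forall>(x :: 'v::infinite) (A :: ('a, 'm) prp). wf_prp A \<longrightarrow> derivable_atomic \<sigma> ([(x, A)], A)) \<and>
         (\<forall>s :: ('v, 'a, 'm) seq. derivable_full \<sigma> s \<longrightarrow> derivable_atomic \<sigma> s)"
  using identity_expansion derivable_full_imp_atomic by blast

end
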